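(* Let $\mathcal{P}=(P_0\ltimes P_1,\{\,,\,\})$ be an admissible Poisson algebra whose induced Lie bracket $[\,,\,]_1$ on $P_1$ is zero, i.e. whose corresponding Poisson triple is of the form $([\,,\,]_1=0,\mathcal{D},\mathcal{K})$. Then there exists an exact sequence of $R$-modules $$0\longrightarrow\mathscr{H}^1_{\mathrm{rest}}(\mathcal{P})\longrightarrow\mathscr{H}^1(\mathcal{P})\longrightarrow\mathscr{E}(\mathcal{P}).$$
   Context: Let $R$ be a commutative ring with unit, $\mathcal{P}_0=(P_0,\cdot,\{\,,\,\}_0)$ a Poisson $R$-algebra (commutative associative unital $R$-algebra with an $R$-bilinear Lie bracket that is a derivation in each argument), $P_1$ a faithful $P_0$-module, and $P=P_0\ltimes P_1$ the $R$-module $P_0\oplus P_1$ with product $(f\oplus\eta)(g\oplus\xi)=fg\oplus(f\xi+g\eta)$. An admissible Poisson structure on $P$ is a Poisson structure with $\mathrm{pr}_0\{f\oplus\eta,g\oplus\xi\}=\{f,g\}_0$; $\mathcal{P}=(P,\{\,,\,\})$ is then an admissible Poisson algebra. $\Omega^1_{P_0}$ is the module of Kähler differentials of $P_0$ over $R$ with universal derivation $d$, anchor $\varrho_{P_0}(dh)=\{h,\cdot\}_0$ (extended $P_0$-linearly). A contravariant derivative on $P_1$ is an $R$-bilinear map $\mathcal{D}:\Omega^1_{P_0}\times P_1\to P_1$ with $\mathcal{D}_{f\alpha}\eta=f\mathcal{D}_\alpha\eta$, $\mathcal{D}_\alpha(f\eta)=f\mathcal{D}_\alpha\eta+\varrho_{P_0}(\alpha)(f)\eta$.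 Every admissible Poisson algebra has a unique corresponding Poisson triple $([\,,\,]_1,\mathcal{D},\mathcal{K})$, where $[\,,\,]_1$ is a $P_0$-linear Lie bracket on $P_1$, $\mathcal{D}$ a contravariant derivative on $P_1$, and $\mathcal{K}:\Omega^1_{P_0}\times\Omega^1_{P_0}\to P_1$ a $P_0$-bilinear skew-symmetric map, such that $\{f\oplus\eta,g\oplus\xi\}=\{f,g\}_0\oplus(\mathcal{D}_{df}\xi-\mathcal{D}_{dg}\eta+[\eta,\xi]_1+\mathcal{K}(df,dg))$. An $R$-linear $X:P\to P$ has components $X_{ij}:P_j\to P_i$, $X(f\oplus\eta)=(X_{00}f+X_{01}\eta)\oplus(X_{10}f+X_{11}\eta)$. $\mathrm{Poiss}(\mathcal{P})$ is the set of derivations of the commutative algebra $P$ that are also derivations of $\{\,,\,\}$; $\mathrm{Ham}(\mathcal{P})=\{\{\pi,\cdot\}\mid\pi\in P\}$; $\mathscr{H}^1(\mathcal{P})=\mathrm{Poiss}(\mathcal{P})/\mathrm{Ham}(\mathcal{P})$. $\mathrm{Poiss}_1(\mathcal{P})=\{X\in\mathrm{Poiss}(\mathcal{P})\mid X_{01}=0\}\supseteq\mathrm{Ham}(\mathcal{P})$ and $\mathscr{H}^1_{\mathrm{rest}}(\mathcal{P})=\mathrm{Poiss}_1(\mathcal{P})/\mathrm{Ham}(\mathcal{P})$. $\mathscr{E}(\mathcal{P})$ is the $R$-module of maps $T:P_1\to P_0$ that are $P_0$-linear and satisfy, for all $f\in P_0$, $\eta,\xi\in P_1$: $T(\xi)\eta+T(\eta)\xi=0$,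 $\ T(\mathcal{D}_{df}\eta)=\{f,T\eta\}_0$, and $\mathcal{D}_{d(T\eta)}\xi=\mathcal{D}_{d(T\xi)}\eta$. *)

theory Defs
  imports "HOL-Algebra.Module" "HOL-Algebra.AbelCoset"
begin

section \<open>Modules\<close>

text \<open>
  The record type of modules extends that of rings, so a module record has fields \<open>mult\<close> and
  \<open>one\<close>; the locale \<open>module\<close> ignores them. Where no product is intended they are \<open>undefined\<close>.
  Sets of maps are made into modules by using extensional functions on the carrier, so that
  equality of elements is equality of maps on the carrier.
\<close>

definition mod_hom ::
    "('r, 'x) ring_scheme \<Rightarrow> ('r, 'm) module \<Rightarrow> ('r, 'n) module \<Rightarrow> ('m \<Rightarrow> 'n) set" where
  "mod_hom R M N = {h \<in> carrier M \<rightarrow> carrier N.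
     (\<forall>x\<in>carrier M. \<forall>y\<in>carrier M. h (x \<oplus>\<^bsub>M\<^esub> y) = h x \<oplus>\<^bsub>N\<^esub> h y) \<and>
     (\<forall>r\<in>carrier R. \<forall>x\<in>carrier M. h (r \<odot>\<^bsub>M\<^esub> x) = r \<odot>\<^bsub>N\<^esub> h x)}"

definition bilinear_maps ::
    "('r, 'x) ring_scheme \<Rightarrow> ('r, 'l) module \<Rightarrow> ('r, 'm) module \<Rightarrow> ('r, 'n) module
      \<Rightarrow> ('l \<Rightarrow> 'm \<Rightarrow> 'n) set" where
  "bilinear_maps R L M N = {b.
     (\<forall>x\<in>carrier L. b x \<in> mod_hom R M N) \<and>
     (\<forall>y\<in>carrier M. (\<lambda>x. b x y) \<in> mod_hom R L N)}"

definition quot_module :: "('r, 'm) module \<Rightarrow> 'm set \<Rightarrow> ('r, 'm set) module" where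
  "quot_module M N =
    \<lparr>carrier = a_rcosets\<^bsub>M\<^esub> N, mult = undefined, one = undefined,
     zero = N, add = set_add M,
     smult = (\<lambda>r C. \<Union>x\<in>C. N +>\<^bsub>M\<^esub> (r \<odot>\<^bsub>M\<^esub> x))\<rparr>"

text \<open>The set \<open>S\<close> of extensional functions \<open>A \<rightarrow> M\<close> with pointwise operations.\<close>

definition fun_module :: "'c set \<Rightarrow> ('r, 'm) module \<Rightarrow> ('c \<Rightarrow> 'm) set \<Rightarrow> ('r, 'c \<Rightarrow> 'm) module" where
  "fun_module A M S =
    \<lparr>carrier = S, mult = undefined, one = undefined,
     zero = (\<lambda>x\<in>A. \<zero>\<^bsub>M\<^esub>), add = (\<lambda>F G. \<lambda>x\<in>A. F x \<oplus>\<^bsub>M\<^esub> G x),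
     smult = (\<lambda>r F. \<lambda>x\<in>A. r \<odot>\<^bsub>M\<^esub> F x)\<rparr>"

definition self_module :: "('r, 'a) module \<Rightarrow> ('a, 'a) module" where
  "self_module A =
    \<lparr>carrier = carrier A, mult = mult A, one = one A, zero = zero A, add = add A,
     smult = mult A\<rparr>"

text \<open>A module over an \<open>R\<close>-algebra \<open>A\<close>, regarded as an \<open>R\<close>-module via \<open>r \<mapsto> r \<odot> 1\<close>.\<close>

definition restrict_scalars :: "('r, 'a) module \<Rightarrow> ('a, 'm) module \<Rightarrow> ('r, 'm) module" where
  "restrict_scalars A M =
    \<lparr>carrier = carrier M, mult = mult M, one = one M, zero = zero M, add = add M,
     smult = (\<lambda>r x. (r \<odot>\<^bsub>A\<^esub> \<one>\<^bsub>A\<^esub>) \<odot>\<^bsub>M\<^esub> x)\<rparr>"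

definition faithful_module :: "('r, 'x) ring_scheme \<Rightarrow> ('r, 'm) module \<Rightarrow> bool" where
  "faithful_module R M \<longleftrightarrow> module R M \<and>
     (\<forall>r\<in>carrier R. (\<forall>x\<in>carrier M. r \<odot>\<^bsub>M\<^esub> x = \<zero>\<^bsub>M\<^esub>) \<longrightarrow> r = \<zero>\<^bsub>R\<^esub>)"

definition gen_submodule :: "('r, 'x) ring_scheme \<Rightarrow> ('r, 'm) module \<Rightarrow> 'm set \<Rightarrow> 'm set" where
  "gen_submodule R M S = \<Inter>{H. submodule H R M \<and> S \<subseteq> H}"

text \<open>
  Exactness of \<open>0 \<rightarrow> A \<rightarrow> B \<rightarrow> C\<close>. The predicate \<open>exact_seq\<close> of HOL-Algebra forces all terms
  to have elements of the same type and does not cover linearity.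
\<close>

definition left_exact_seq ::
    "('r, 'x) ring_scheme \<Rightarrow> ('r, 'a) module \<Rightarrow> ('r, 'b) module \<Rightarrow> ('r, 'c) module
      \<Rightarrow> ('a \<Rightarrow> 'b) \<Rightarrow> ('b \<Rightarrow> 'c) \<Rightarrow> bool" where
  "left_exact_seq R A B C \<iota> \<phi> \<longleftrightarrow>
     module R A \<and> module R B \<and> module R C \<and>
     \<iota> \<in> mod_hom R A B \<and> \<phi> \<in> mod_hom R B C \<and>
     a_kernel A B \<iota> = {\<zero>\<^bsub>A\<^esub>} \<and> a_kernel B C \<phi> = \<iota> ` carrier A"


section \<open>Kaehler differentials\<close>

text \<open>
  The module of differentials of \<open>A\<close> over \<open>R\<close>: the free \<open>A\<close>-module on symbols \<open>df\<close>
  (finitely supported functions on the carrier of \<open>A\<close>) modulo \<open>R\<close>-linearity of \<open>d\<close> and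
  the Leibniz rule.
\<close>

definition kaehler_free :: "('r, 'a) module \<Rightarrow> ('a, 'a \<Rightarrow> 'a) module" where
  "kaehler_free A = fun_module (carrier A) (self_module A)
     {c \<in> carrier A \<rightarrow>\<^sub>E carrier A. finite {h \<in> carrier A. c h \<noteq> \<zero>\<^bsub>A\<^esub>}}"

definition kaehler_symbol :: "('r, 'a) module \<Rightarrow> 'a \<Rightarrow> ('a \<Rightarrow> 'a)" where
  "kaehler_symbol A f = (\<lambda>h\<in>carrier A. if h = f then \<one>\<^bsub>A\<^esub> else \<zero>\<^bsub>A\<^esub>)"

definition kaehler_relations :: "('r, 'x) ring_scheme \<Rightarrow> ('r, 'a) module \<Rightarrow> ('a \<Rightarrow> 'a) set" where
  "kaehler_relations R A =
    (let F = kaehler_free A; \<delta> = kaehler_symbol A in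
      {\<delta> (f \<oplus>\<^bsub>A\<^esub> g) \<ominus>\<^bsub>F\<^esub> (\<delta> f \<oplus>\<^bsub>F\<^esub> \<delta> g) |f g. f \<in> carrier A \<and> g \<in> carrier A} \<union>
      {\<delta> (r \<odot>\<^bsub>A\<^esub> f) \<ominus>\<^bsub>F\<^esub> (r \<odot>\<^bsub>A\<^esub> \<one>\<^bsub>A\<^esub>) \<odot>\<^bsub>F\<^esub> \<delta> f |r f. r \<in> carrier R \<and> f \<in> carrier A} \<union>
      {\<delta> (f \<otimes>\<^bsub>A\<^esub> g) \<ominus>\<^bsub>F\<^esub> (f \<odot>\<^bsub>F\<^esub> \<delta> g \<oplus>\<^bsub>F\<^esub> g \<odot>\<^bsub>F\<^esub> \<delta> f) |f g. f \<in> carrier A \<and> g \<in> carrier A})"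

definition kaehler_submodule :: "('r, 'x) ring_scheme \<Rightarrow> ('r, 'a) module \<Rightarrow> ('a \<Rightarrow> 'a) set" where
  "kaehler_submodule R A = gen_submodule A (kaehler_free A) (kaehler_relations R A)"

definition kaehler :: "('r, 'x) ring_scheme \<Rightarrow> ('r, 'a) module \<Rightarrow> ('a, ('a \<Rightarrow> 'a) set) module" where
  "kaehler R A = quot_module (kaehler_free A) (kaehler_submodule R A)"

definition kaehler_d :: "('r, 'x) ring_scheme \<Rightarrow> ('r, 'a) module \<Rightarrow> 'a \<Rightarrow> ('a \<Rightarrow> 'a) set" where
  "kaehler_d R A f = kaehler_submodule R A +>\<^bsub>kaehler_free A\<^esub> kaehler_symbol A f"


section \<open>Poisson algebras\<close>

definition derivations :: "('r, 'x) ring_scheme \<Rightarrow> ('r, 'a) module \<Rightarrow> ('a \<Rightarrow> 'a) set" where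
  "derivations R A = {X \<in> mod_hom R A A.
     \<forall>a\<in>carrier A. \<forall>b\<in>carrier A. X (a \<otimes>\<^bsub>A\<^esub> b) = a \<otimes>\<^bsub>A\<^esub> X b \<oplus>\<^bsub>A\<^esub> X a \<otimes>\<^bsub>A\<^esub> b}"

definition lie_bracket ::
    "('r, 'x) ring_scheme \<Rightarrow> ('r, 'm) module \<Rightarrow> ('m \<Rightarrow> 'm \<Rightarrow> 'm) \<Rightarrow> bool" where
  "lie_bracket R M br \<longleftrightarrow>
     br \<in> bilinear_maps R M M M \<and>
     (\<forall>x\<in>carrier M. br x x = \<zero>\<^bsub>M\<^esub>) \<and>
     (\<forall>x\<in>carrier M. \<forall>y\<in>carrier M. \<forall>z\<in>carrier M.
        br x (br y z) \<oplus>\<^bsub>M\<^esub> br y (br z x) \<oplus>\<^bsub>M\<^esub> br z (br x y) = \<zero>\<^bsub>M\<^esub>)"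

locale poisson_algebra = algebra R A for R (structure) and A (structure) +
  fixes br :: "'c \<Rightarrow> 'c \<Rightarrow> 'c"
  assumes lie: "lie_bracket R A br"
    and deriv_right: "a \<in> carrier A \<Longrightarrow> (\<lambda>b. br a b) \<in> derivations R A"
    and deriv_left: "b \<in> carrier A \<Longrightarrow> (\<lambda>a. br a b) \<in> derivations R A"

definition poiss :: "('r, 'x) ring_scheme \<Rightarrow> ('r, 'a) module \<Rightarrow> ('a \<Rightarrow> 'a \<Rightarrow> 'a) \<Rightarrow> ('a \<Rightarrow> 'a) set" where
  "poiss R A br = {X \<in> derivations R A \<inter> extensional (carrier A).
     \<forall>a\<in>carrier A. \<forall>b\<in>carrier A. X (br a b) = br (X a) b \<oplus>\<^bsub>A\<^esub> br a (X b)}"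

definition ham :: "('r, 'a) module \<Rightarrow> ('a \<Rightarrow> 'a \<Rightarrow> 'a) \<Rightarrow> ('a \<Rightarrow> 'a) set" where
  "ham A br = (\<lambda>\<pi>. \<lambda>a\<in>carrier A. br \<pi> a) ` carrier A"

definition poisson_H1 ::
    "('r, 'x) ring_scheme \<Rightarrow> ('r, 'a) module \<Rightarrow> ('a \<Rightarrow> 'a \<Rightarrow> 'a) \<Rightarrow> ('r, ('a \<Rightarrow> 'a) set) module" where
  "poisson_H1 R A br = quot_module (fun_module (carrier A) A (poiss R A br)) (ham A br)"

text \<open>
  The anchor \<open>\<Sum>\<^sub>h c\<^sub>h dh \<mapsto> \<Sum>\<^sub>h c\<^sub>h {h, \<cdot>}\<close>; \<open>the_elem\<close> picks the common value on all
  representatives of a class.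
\<close>

definition anchor ::
    "('r, 'a) module \<Rightarrow> ('a \<Rightarrow> 'a \<Rightarrow> 'a) \<Rightarrow> ('a \<Rightarrow> 'a) set \<Rightarrow> 'a \<Rightarrow> 'a" where
  "anchor A br \<alpha> f =
     the_elem ((\<lambda>c. \<Oplus>\<^bsub>A\<^esub>h \<in> {h \<in> carrier A. c h \<noteq> \<zero>\<^bsub>A\<^esub>}. c h \<otimes>\<^bsub>A\<^esub> br h f) ` \<alpha>)"


section \<open>Admissible Poisson algebras\<close>

definition semidirect :: "('r, 'a) module \<Rightarrow> ('a, 'b) module \<Rightarrow> ('r, 'a \<times> 'b) module"
    (infixl "\<ltimes>" 65) where
  "A \<ltimes> M =
    \<lparr>carrier = carrier A \<times> carrier M,
     mult = (\<lambda>(f, \<eta>) (g, \<xi>). (f \<otimes>\<^bsub>A\<^esub> g, f \<odot>\<^bsub>M\<^esub> \<xi> \<oplus>\<^bsub>M\<^esub> g \<odot>\<^bsub>M\<^esub> \<eta>)),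
     one = (\<one>\<^bsub>A\<^esub>, \<zero>\<^bsub>M\<^esub>),
     zero = (\<zero>\<^bsub>A\<^esub>, \<zero>\<^bsub>M\<^esub>),
     add = (\<lambda>(f, \<eta>) (g, \<xi>). (f \<oplus>\<^bsub>A\<^esub> g, \<eta> \<oplus>\<^bsub>M\<^esub> \<xi>)),
     smult = (\<lambda>r (f, \<eta>). (r \<odot>\<^bsub>A\<^esub> f, (r \<odot>\<^bsub>A\<^esub> \<one>\<^bsub>A\<^esub>) \<odot>\<^bsub>M\<^esub> \<eta>))\<rparr>"

locale admissible_poisson_algebra =
  P0: poisson_algebra R P0 br0 + P: poisson_algebra R "P0 \<ltimes> P1" br
  for R :: "('r, 'x) ring_scheme" and P0 :: "('r, 'a) module" and br0 :: "'a \<Rightarrow> 'a \<Rightarrow> 'a"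
    and P1 :: "('a, 'b) module" and br :: "'a \<times> 'b \<Rightarrow> 'a \<times> 'b \<Rightarrow> 'a \<times> 'b" +
  assumes faithful: "faithful_module P0 P1"
    and pr0: "\<lbrakk>f \<in> carrier P0; g \<in> carrier P0; \<eta> \<in> carrier P1; \<xi> \<in> carrier P1\<rbrakk>
      \<Longrightarrow> fst (br (f, \<eta>) (g, \<xi>)) = br0 f g"

definition contravariant_derivative ::
    "('r, 'x) ring_scheme \<Rightarrow> ('r, 'a) module \<Rightarrow> ('a \<Rightarrow> 'a \<Rightarrow> 'a) \<Rightarrow> ('a, 'b) module
      \<Rightarrow> (('a \<Rightarrow> 'a) set \<Rightarrow> 'b \<Rightarrow> 'b) \<Rightarrow> bool" where
  "contravariant_derivative R P0 br0 P1 D \<longleftrightarrow>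
     D \<in> bilinear_maps R (restrict_scalars P0 (kaehler R P0)) (restrict_scalars P0 P1)
           (restrict_scalars P0 P1) \<and>
     (\<forall>f\<in>carrier P0. \<forall>\<alpha>\<in>carrier (kaehler R P0). \<forall>\<eta>\<in>carrier P1.
        D (f \<odot>\<^bsub>kaehler R P0\<^esub> \<alpha>) \<eta> = f \<odot>\<^bsub>P1\<^esub> D \<alpha> \<eta> \<and>
        D \<alpha> (f \<odot>\<^bsub>P1\<^esub> \<eta>) = f \<odot>\<^bsub>P1\<^esub> D \<alpha> \<eta> \<oplus>\<^bsub>P1\<^esub> anchor P0 br0 \<alpha> f \<odot>\<^bsub>P1\<^esub> \<eta>)"

definition corresponding_poisson_triple ::
    "('r, 'x) ring_scheme \<Rightarrow> ('r, 'a) module \<Rightarrow> ('a \<Rightarrow> 'a \<Rightarrow> 'a) \<Rightarrow> ('a, 'b) module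
      \<Rightarrow> ('a \<times> 'b \<Rightarrow> 'a \<times> 'b \<Rightarrow> 'a \<times> 'b)
      \<Rightarrow> ('b \<Rightarrow> 'b \<Rightarrow> 'b) \<Rightarrow> (('a \<Rightarrow> 'a) set \<Rightarrow> 'b \<Rightarrow> 'b)
      \<Rightarrow> (('a \<Rightarrow> 'a) set \<Rightarrow> ('a \<Rightarrow> 'a) set \<Rightarrow> 'b) \<Rightarrow> bool" where
  "corresponding_poisson_triple R P0 br0 P1 br br1 D K \<longleftrightarrow>
     lie_bracket P0 P1 br1 \<and>
     contravariant_derivative R P0 br0 P1 D \<and>
     K \<in> bilinear_maps P0 (kaehler R P0) (kaehler R P0) P1 \<and>
     (\<forall>\<alpha>\<in>carrier (kaehler R P0). \<forall>\<beta>\<in>carrier (kaehler R P0). K \<alpha> \<beta> = \<ominus>\<^bsub>P1\<^esub> K \<beta> \<alpha>) \<and>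
     (\<forall>f\<in>carrier P0. \<forall>g\<in>carrier P0. \<forall>\<eta>\<in>carrier P1. \<forall>\<xi>\<in>carrier P1.
        let df = kaehler_d R P0 f; dg = kaehler_d R P0 g in
        br (f, \<eta>) (g, \<xi>) =
          (br0 f g, D df \<xi> \<ominus>\<^bsub>P1\<^esub> D dg \<eta> \<oplus>\<^bsub>P1\<^esub> br1 \<eta> \<xi> \<oplus>\<^bsub>P1\<^esub> K df dg))"

text \<open>The component \<open>X\<^sub>0\<^sub>1\<close> is \<open>\<eta> \<mapsto> fst (X (0, \<eta>))\<close>.\<close>

definition poiss1 ::
    "('r, 'x) ring_scheme \<Rightarrow> ('r, 'a) module \<Rightarrow> ('a, 'b) module
      \<Rightarrow> ('a \<times> 'b \<Rightarrow> 'a \<times> 'b \<Rightarrow> 'a \<times> 'b) \<Rightarrow> ('a \<times> 'b \<Rightarrow> 'a \<times> 'b) set" where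
  "poiss1 R P0 P1 br =
     {X \<in> poiss R (P0 \<ltimes> P1) br. \<forall>\<eta>\<in>carrier P1. fst (X (\<zero>\<^bsub>P0\<^esub>, \<eta>)) = \<zero>\<^bsub>P0\<^esub>}"

definition poisson_H1_rest ::
    "('r, 'x) ring_scheme \<Rightarrow> ('r, 'a) module \<Rightarrow> ('a, 'b) module
      \<Rightarrow> ('a \<times> 'b \<Rightarrow> 'a \<times> 'b \<Rightarrow> 'a \<times> 'b) \<Rightarrow> ('r, ('a \<times> 'b \<Rightarrow> 'a \<times> 'b) set) module" where
  "poisson_H1_rest R P0 P1 br =
     quot_module (fun_module (carrier (P0 \<ltimes> P1)) (P0 \<ltimes> P1) (poiss1 R P0 P1 br)) (ham (P0 \<ltimes> P1) br)"

text \<open>The module depends on the bracket of \<open>P\<close> only through the component \<open>D\<close> of its Poisson triple.\<close>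

definition E_module ::
    "('r, 'x) ring_scheme \<Rightarrow> ('r, 'a) module \<Rightarrow> ('a \<Rightarrow> 'a \<Rightarrow> 'a) \<Rightarrow> ('a, 'b) module
      \<Rightarrow> (('a \<Rightarrow> 'a) set \<Rightarrow> 'b \<Rightarrow> 'b) \<Rightarrow> ('r, 'b \<Rightarrow> 'a) module" where
  "E_module R P0 br0 P1 D = fun_module (carrier P1) P0
     {T \<in> mod_hom P0 P1 (self_module P0) \<inter> extensional (carrier P1).
        (\<forall>\<eta>\<in>carrier P1. \<forall>\<xi>\<in>carrier P1.
           T \<xi> \<odot>\<^bsub>P1\<^esub> \<eta> \<oplus>\<^bsub>P1\<^esub> T \<eta> \<odot>\<^bsub>P1\<^esub> \<xi> = \<zero>\<^bsub>P1\<^esub> \<and>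
           D (kaehler_d R P0 (T \<eta>)) \<xi> = D (kaehler_d R P0 (T \<xi>)) \<eta>) \<and>
        (\<forall>f\<in>carrier P0. \<forall>\<eta>\<in>carrier P1. T (D (kaehler_d R P0 f) \<eta>) = br0 f (T \<eta>))}"

end

theory Submission
  imports Defs
begin

text \<open>
  The map to \<open>\<E>(P)\<close> sends the class of a Poisson derivation \<open>X\<close> to its component \<open>X\<^sub>0\<^sub>1\<close>. The conditions
  defining \<open>\<E>(P)\<close> are the components of the derivation rules for \<open>X\<close> on \<open>(f, 0)(0, \<eta>)\<close>,
  \<open>(0, \<eta>)(0, \<xi>) = 0\<close>, \<open>{(f, 0), (0, \<eta>)} = (0, D\<^sub>d\<^sub>f \<eta>)\<close> and \<open>{(0, \<eta>), (0, \<xi>)} = 0\<close>; the last equation is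
  where the vanishing of \<open>[,]\<^sub>1\<close> enters. Hamiltonian derivations have \<open>X\<^sub>0\<^sub>1 = 0\<close>, so \<open>X \<mapsto> X\<^sub>0\<^sub>1\<close>
  descends to the quotient, and its kernel there consists of the classes of derivations with
  \<open>X\<^sub>0\<^sub>1 = 0\<close>.
\<close>

section \<open>Modules of functions and quotient modules\<close>

lemma fun_module_simps [simp]:
  "carrier (fun_module A M S) = S"
  "\<zero>\<^bsub>fun_module A M S\<^esub> = (\<lambda>x\<in>A. \<zero>\<^bsub>M\<^esub>)"
  "F \<oplus>\<^bsub>fun_module A M S\<^esub> G = (\<lambda>x\<in>A. F x \<oplus>\<^bsub>M\<^esub> G x)"
  "r \<odot>\<^bsub>fun_module A M S\<^esub> F = (\<lambda>x\<in>A. r \<odot>\<^bsub>M\<^esub> F x)"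
  by (simp_all add: fun_module_def)

lemma quot_module_simps [simp]:
  "carrier (quot_module M N) = a_rcosets\<^bsub>M\<^esub> N"
  "\<zero>\<^bsub>quot_module M N\<^esub> = N"
  "C \<oplus>\<^bsub>quot_module M N\<^esub> C' = C <+>\<^bsub>M\<^esub> C'"
  "r \<odot>\<^bsub>quot_module M N\<^esub> C = (\<Union>x\<in>C. N +>\<^bsub>M\<^esub> (r \<odot>\<^bsub>M\<^esub> x))"
  by (simp_all add: quot_module_def)

text \<open>Negatives arise as multiples by \<open>-1\<close>, so closure under sums and scalars
  suffices. Extensionality of the members of \<open>S\<close> is what gives \<open>0 + F = F\<close>
  and \<open>1 F = F\<close>.\<close>

lemma fun_module_is_module:
  fixes R :: "('r, 'x) ring_scheme" and M :: "('r, 'm) module"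
  assumes M: "module R M" and sub: "S \<subseteq> A \<rightarrow>\<^sub>E carrier M"
    and zero: "(\<lambda>x\<in>A. \<zero>\<^bsub>M\<^esub>) \<in> S"
    and add: "\<And>F G. \<lbrakk>F \<in> S; G \<in> S\<rbrakk> \<Longrightarrow> (\<lambda>x\<in>A. F x \<oplus>\<^bsub>M\<^esub> G x) \<in> S"
    and smult: "\<And>r F. \<lbrakk>r \<in> carrier R; F \<in> S\<rbrakk> \<Longrightarrow> (\<lambda>x\<in>A. r \<odot>\<^bsub>M\<^esub> F x) \<in> S"
  shows "module R (fun_module A M S)"
proof -
  interpret module R M by (rule M)
  have val: "F x \<in> carrier M" if "F \<in> S" "x \<in> A" for F x
    using sub that by auto
  have ext: "F \<in> extensional A" if "F \<in> S" for F
    using sub that by (auto simp: PiE_def)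
  show ?thesis
  proof (rule moduleI, rule R.is_cring)
    show "abelian_group (fun_module A M S)"
    proof (rule abelian_groupI)
      fix F assume F: "F \<in> carrier (fun_module A M S)"
      have "(\<lambda>x\<in>A. (\<ominus>\<^bsub>R\<^esub> \<one>\<^bsub>R\<^esub>) \<odot>\<^bsub>M\<^esub> F x) \<in> S"
        using F smult by simp
      moreover have "(\<lambda>x\<in>A. (\<ominus>\<^bsub>R\<^esub> \<one>\<^bsub>R\<^esub>) \<odot>\<^bsub>M\<^esub> F x) \<oplus>\<^bsub>fun_module A M S\<^esub> F = \<zero>\<^bsub>fun_module A M S\<^esub>"
        using F val by (auto simp: smult_l_minus M.l_neg fun_eq_iff)
      ultimately show "\<exists>G\<in>carrier (fun_module A M S). G \<oplus>\<^bsub>fun_module A M S\<^esub> F = \<zero>\<^bsub>fun_module A M S\<^esub>"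
        by (metis fun_module_simps(1))
    next
      fix F assume F: "F \<in> carrier (fun_module A M S)"
      show "\<zero>\<^bsub>fun_module A M S\<^esub> \<oplus>\<^bsub>fun_module A M S\<^esub> F = F"
        using F val ext by (intro extensionalityI[where A = A]) auto
    qed (use zero add val in \<open>auto simp: fun_eq_iff M.a_ac\<close>)
  next
    fix F assume F: "F \<in> carrier (fun_module A M S)"
    show "\<one>\<^bsub>R\<^esub> \<odot>\<^bsub>fun_module A M S\<^esub> F = F"
      using F val ext by (intro extensionalityI[where A = A]) auto
  qed (use smult val in \<open>auto simp: fun_eq_iff smult_l_distr smult_r_distr smult_assoc1\<close>)
qed

section \<open>Quotients by a submodule\<close>

lemma (in module) submodule_abelian_subgroup:
  assumes "submodule N R M"
  shows "abelian_subgroup N M"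
  by (intro abelian_subgroupI3 additive_subgroup.intro submodule.axioms(1)[OF assms] M.abelian_group_axioms)

text \<open>The scalar action on a class is a union over its representatives; all members of that
  union coincide because \<open>r (y - x)\<close> lies in \<open>N\<close> whenever
  \<open>y - x\<close> does.\<close>

lemma (in module) quot_smult_coset:
  assumes N: "submodule N R M" and r: "r \<in> carrier R" and x: "x \<in> carrier M"
  shows "(\<Union>y\<in>N +>\<^bsub>M\<^esub> x. N +>\<^bsub>M\<^esub> (r \<odot>\<^bsub>M\<^esub> y)) = N +>\<^bsub>M\<^esub> (r \<odot>\<^bsub>M\<^esub> x)"
proof -
  interpret N: abelian_subgroup N M by (rule submodule_abelian_subgroup[OF N])
  have "N +>\<^bsub>M\<^esub> (r \<odot>\<^bsub>M\<^esub> y) = N +>\<^bsub>M\<^esub> (r \<odot>\<^bsub>M\<^esub> x)" if y: "y \<in> N +>\<^bsub>M\<^esub> x" for y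
  proof -
    have yc: "y \<in> carrier M" using N.a_elemrcos_carrier[OF x y] .
    have "r \<odot>\<^bsub>M\<^esub> (y \<oplus>\<^bsub>M\<^esub> \<ominus>\<^bsub>M\<^esub> x) \<in> N"
      using submoduleE(4)[OF N r N.a_rcos_module_imp[OF x y]] .
    then have "r \<odot>\<^bsub>M\<^esub> y \<oplus>\<^bsub>M\<^esub> \<ominus>\<^bsub>M\<^esub> (r \<odot>\<^bsub>M\<^esub> x) \<in> N"
      using r x yc by (simp add: smult_r_distr smult_r_minus)
    then have "r \<odot>\<^bsub>M\<^esub> y \<in> N +>\<^bsub>M\<^esub> (r \<odot>\<^bsub>M\<^esub> x)"
      using r x yc by (intro N.a_rcos_module_rev) auto
    then show ?thesis using N.a_repr_independence' r x by auto
  qed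
  moreover have "x \<in> N +>\<^bsub>M\<^esub> x" by (rule N.a_rcos_self[OF x])
  ultimately show ?thesis by blast
qed

text \<open>Every class is \<open>N + x\<close> for some \<open>x\<close>, and all operations are
  computed on representatives, so the module axioms are inherited from \<open>M\<close>.\<close>

lemma quot_module_is_module:
  fixes R :: "('r, 'x) ring_scheme" and M :: "('r, 'm) module"
  assumes M: "module R M" and N: "submodule N R M"
  shows "module R (quot_module M N)"
proof -
  interpret module R M by (rule M)
  interpret N: abelian_subgroup N M by (rule submodule_abelian_subgroup[OF N])
  have full: "carrier (quot_module M N) = (\<lambda>x. N +>\<^bsub>M\<^esub> x) ` carrier M"
    by (auto simp: A_RCOSETS_def')
  have zero: "\<zero>\<^bsub>quot_module M N\<^esub> = N +>\<^bsub>M\<^esub> \<zero>\<^bsub>M\<^esub>"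
    by (simp add: N.a_rcos_const)
  have add: "(N +>\<^bsub>M\<^esub> x) \<oplus>\<^bsub>quot_module M N\<^esub> (N +>\<^bsub>M\<^esub> y) = N +>\<^bsub>M\<^esub> (x \<oplus>\<^bsub>M\<^esub> y)"
    if "x \<in> carrier M" "y \<in> carrier M" for x y
    using that by (simp add: N.a_rcos_sum)
  have smult: "r \<odot>\<^bsub>quot_module M N\<^esub> (N +>\<^bsub>M\<^esub> x) = N +>\<^bsub>M\<^esub> (r \<odot>\<^bsub>M\<^esub> x)"
    if "r \<in> carrier R" "x \<in> carrier M" for r x
    using that by (simp add: quot_smult_coset[OF N])
  have neg: "\<exists>y\<in>carrier M. N +>\<^bsub>M\<^esub> (y \<oplus>\<^bsub>M\<^esub> x) = N +>\<^bsub>M\<^esub> \<zero>\<^bsub>M\<^esub>" if "x \<in> carrier M" for x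
    using that M.l_neg by (metis M.a_inv_closed)
  note [simp del] = quot_module_simps
  show ?thesis
  proof (rule moduleI, rule R.is_cring)
    show "abelian_group (quot_module M N)"
      by (rule abelian_groupI) (use neg in \<open>auto simp: full zero add M.a_ac\<close>)
  qed (auto simp: full add smult smult_l_distr smult_r_distr smult_assoc1)
qed

section \<open>Linear maps, their kernels and induced maps on quotients\<close>

lemma mod_homD:
  assumes "h \<in> mod_hom R M N"
  shows "x \<in> carrier M \<Longrightarrow> h x \<in> carrier N"
    and "\<lbrakk>x \<in> carrier M; y \<in> carrier M\<rbrakk> \<Longrightarrow> h (x \<oplus>\<^bsub>M\<^esub> y) = h x \<oplus>\<^bsub>N\<^esub> h y"
    and "\<lbrakk>r \<in> carrier R; x \<in> carrier M\<rbrakk> \<Longrightarrow> h (r \<odot>\<^bsub>M\<^esub> x) = r \<odot>\<^bsub>N\<^esub> h x"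
  using assms by (auto simp: mod_hom_def)

lemma mod_hom_zero:
  assumes "abelian_group M" "abelian_group N" "h \<in> mod_hom R M N"
  shows "h \<zero>\<^bsub>M\<^esub> = \<zero>\<^bsub>N\<^esub>"
proof -
  interpret M: abelian_group M by fact
  interpret N: abelian_group N by fact
  have "h \<zero>\<^bsub>M\<^esub> \<oplus>\<^bsub>N\<^esub> h \<zero>\<^bsub>M\<^esub> = h \<zero>\<^bsub>M\<^esub>"
    using mod_homD(2)[OF assms(3), of "\<zero>\<^bsub>M\<^esub>" "\<zero>\<^bsub>M\<^esub>"] by simp
  then show ?thesis
    using mod_homD(1)[OF assms(3), of "\<zero>\<^bsub>M\<^esub>"] by (simp add: N.add.l_cancel_one)
qed

lemma submodule_a_kernel:
  fixes R :: "('r, 'x) ring_scheme" and M :: "('r, 'm) module"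
  assumes M: "module R M" and L: "module R L" and h: "h \<in> mod_hom R M L"
  shows "submodule (a_kernel M L h) R M"
proof -
  interpret module R M by (rule M)
  interpret L: module R L by (rule L)
  note [simp] = mod_homD[OF h] mod_hom_zero[OF M.abelian_group_axioms L.abelian_group_axioms h]
  \<comment> \<open>Negation is multiplication by \<open>-1\<close>, hence covered by the linearity
    of \<open>h\<close>.\<close>
  have "h (\<ominus>\<^bsub>M\<^esub> x) = \<zero>\<^bsub>L\<^esub>" if "x \<in> carrier M" "h x = \<zero>\<^bsub>L\<^esub>" for x
    using mod_homD(3)[OF h, of "\<ominus>\<^bsub>R\<^esub> \<one>\<^bsub>R\<^esub>" x] that by (simp add: smult_l_minus)
  then show ?thesis
    by (intro submoduleI) (auto simp: a_kernel_def')
qed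

text \<open>The value on an arbitrary representative; meaningful only if \<open>h\<close> is constant on \<open>C\<close>.\<close>

definition coset_map :: "('m \<Rightarrow> 'n) \<Rightarrow> 'm set \<Rightarrow> 'n" where
  "coset_map h C = h (SOME x. x \<in> C)"

text \<open>Members of a class differ by elements of \<open>N\<close>, which \<open>h\<close> kills
  by \<open>ker\<close>, so the chosen representative does not matter.\<close>

lemma coset_map_coset:
  fixes R :: "('r, 'x) ring_scheme" and M :: "('r, 'm) module"
  assumes M: "module R M" and N: "submodule N R M" and L: "module R L" and h: "h \<in> mod_hom R M L"
    and ker: "N \<subseteq> a_kernel M L h" and x: "x \<in> carrier M"
  shows "coset_map h (N +>\<^bsub>M\<^esub> x) = h x"
proof -
  interpret module R M by (rule M)
  interpret L: module R L by (rule L)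
  interpret N: abelian_subgroup N M by (rule submodule_abelian_subgroup[OF N])
  have "h y = h x" if y: "y \<in> N +>\<^bsub>M\<^esub> x" for y
  proof -
    obtain n where n: "n \<in> N" "y = n \<oplus>\<^bsub>M\<^esub> x"
      using y by (auto simp: a_r_coset_def')
    then have "h n = \<zero>\<^bsub>L\<^esub>" "n \<in> carrier M" using ker by (auto simp: a_kernel_def')
    then show ?thesis using n x mod_homD(1,2)[OF h] by simp
  qed
  moreover have "(SOME y. y \<in> N +>\<^bsub>M\<^esub> x) \<in> N +>\<^bsub>M\<^esub> x"
    by (rule someI[of _ x]) (rule N.a_rcos_self[OF x])
  ultimately show ?thesis
    unfolding coset_map_def by blast
qed

text \<open>A coset is built from the addition alone, so cosets formed in a submodule and in the
  whole module are the same sets.\<close>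

lemma coset_cong_carrier [simp]: "N +>\<^bsub>M\<lparr>carrier := H\<rparr>\<^esub> x = N +>\<^bsub>M\<^esub> x"
  by (simp add: a_r_coset_def')

text \<open>The algebraic core: the kernel of the map that \<open>h\<close> induces on
  \<open>M/N\<close> is the kernel of \<open>h\<close> modulo \<open>N\<close>. It is applied below
  with \<open>comp01\<close> as \<open>h\<close> and the Hamiltonian derivations as
  \<open>N\<close>.\<close>

lemma quot_left_exact:
  fixes R :: "('r, 'x) ring_scheme" and M :: "('r, 'm) module"
  assumes M: "module R M" and N: "submodule N R M" and L: "module R L" and h: "h \<in> mod_hom R M L"
    and ker: "N \<subseteq> a_kernel M L h"
  shows "left_exact_seq R (quot_module (M\<lparr>carrier := a_kernel M L h\<rparr>) N) (quot_module M N) L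
           (\<lambda>C. C) (coset_map h)"
proof -
  interpret module R M by (rule M)
  interpret L: module R L by (rule L)
  interpret N: abelian_subgroup N M by (rule submodule_abelian_subgroup[OF N])
  define H where "H = a_kernel M L h"
  have HS: "submodule H R M" unfolding H_def by (rule submodule_a_kernel[OF M L h])
  have HM: "module R (M\<lparr>carrier := H\<rparr>)"
    by (rule submodule.submodule_is_module[OF HS module_axioms])
  \<comment> \<open>An additive inverse is defined as an element of the carrier, so it has to be
    checked that shrinking the carrier to \<open>H\<close> keeps it.\<close>
  have inv: "\<ominus>\<^bsub>M\<lparr>carrier := H\<rparr>\<^esub> x = \<ominus>\<^bsub>M\<^esub> x" if "x \<in> H" for x
    using M.add.m_inv_consistent[OF submodule.axioms(1)[OF HS] that] by (simp add: a_inv_def)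
  have NH: "submodule N R (M\<lparr>carrier := H\<rparr>)"
  proof (rule module.submoduleI[OF HM])
    show "\<ominus>\<^bsub>M\<lparr>carrier := H\<rparr>\<^esub> a \<in> N" if "a \<in> N" for a
      using that ker submoduleE(3)[OF N] by (subst inv) (auto simp: H_def)
  qed (use ker submoduleE[OF N] in \<open>auto simp: H_def\<close>)
  note [simp] = coset_map_coset[OF M N L h ker]
  have sub: "a_rcosets\<^bsub>M\<lparr>carrier := H\<rparr>\<^esub> N = (\<lambda>x. N +>\<^bsub>M\<^esub> x) ` H"
    by (auto simp: A_RCOSETS_def')
  have full: "a_rcosets\<^bsub>M\<^esub> N = (\<lambda>x. N +>\<^bsub>M\<^esub> x) ` carrier M"
    by (auto simp: A_RCOSETS_def')
  have HC: "H \<subseteq> carrier M" by (auto simp: H_def a_kernel_def')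
  have incl: "(\<lambda>C. C) \<in> mod_hom R (quot_module (M\<lparr>carrier := H\<rparr>) N) (quot_module M N)"
    using HC by (auto simp: mod_hom_def sub full set_add_def')
  have phi: "coset_map h \<in> mod_hom R (quot_module M N) L"
    using mod_homD[OF h]
    by (auto simp: mod_hom_def full N.a_rcos_sum quot_smult_coset[OF N])
  \<comment> \<open>\<open>N\<close> must be an actual class of the smaller quotient; otherwise the
    kernel of the inclusion would be empty instead of \<open>{N}\<close>.\<close>
  have "N \<in> (\<lambda>x. N +>\<^bsub>M\<^esub> x) ` H"
    using submoduleE(1,2)[OF HS] abelian_subgroup.a_subgroup_in_rcosets[OF
      module.submodule_abelian_subgroup[OF HM NH]] by (simp add: sub)
  then have "a_kernel (quot_module (M\<lparr>carrier := H\<rparr>) N) (quot_module M N) (\<lambda>C. C) = {N}"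
    by (auto simp: a_kernel_def' sub)
  moreover have "a_kernel (quot_module M N) L (coset_map h) = (\<lambda>x. N +>\<^bsub>M\<^esub> x) ` H"
    by (auto simp: a_kernel_def' full H_def)
  ultimately show ?thesis
    using quot_module_is_module[OF M N] quot_module_is_module[OF HM NH] L incl phi
    unfolding left_exact_seq_def H_def[symmetric] by (simp add: sub)
qed


section \<open>Poisson derivations\<close>

lemma derivationsI:
  assumes "\<And>a. a \<in> carrier A \<Longrightarrow> X a \<in> carrier A"
    and "\<And>a b. \<lbrakk>a \<in> carrier A; b \<in> carrier A\<rbrakk> \<Longrightarrow> X (a \<oplus>\<^bsub>A\<^esub> b) = X a \<oplus>\<^bsub>A\<^esub> X b"
    and "\<And>r a. \<lbrakk>r \<in> carrier R; a \<in> carrier A\<rbrakk> \<Longrightarrow> X (r \<odot>\<^bsub>A\<^esub> a) = r \<odot>\<^bsub>A\<^esub> X a"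
    and "\<And>a b. \<lbrakk>a \<in> carrier A; b \<in> carrier A\<rbrakk>
      \<Longrightarrow> X (a \<otimes>\<^bsub>A\<^esub> b) = a \<otimes>\<^bsub>A\<^esub> X b \<oplus>\<^bsub>A\<^esub> X a \<otimes>\<^bsub>A\<^esub> b"
  shows "X \<in> derivations R A"
  using assms by (auto simp: derivations_def mod_hom_def)

lemma derivationsD:
  assumes "X \<in> derivations R A"
  shows "a \<in> carrier A \<Longrightarrow> X a \<in> carrier A"
    and "\<lbrakk>a \<in> carrier A; b \<in> carrier A\<rbrakk> \<Longrightarrow> X (a \<oplus>\<^bsub>A\<^esub> b) = X a \<oplus>\<^bsub>A\<^esub> X b"
    and "\<lbrakk>r \<in> carrier R; a \<in> carrier A\<rbrakk> \<Longrightarrow> X (r \<odot>\<^bsub>A\<^esub> a) = r \<odot>\<^bsub>A\<^esub> X a"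
    and "\<lbrakk>a \<in> carrier A; b \<in> carrier A\<rbrakk>
      \<Longrightarrow> X (a \<otimes>\<^bsub>A\<^esub> b) = a \<otimes>\<^bsub>A\<^esub> X b \<oplus>\<^bsub>A\<^esub> X a \<otimes>\<^bsub>A\<^esub> b"
  using assms by (auto simp: derivations_def mod_hom_def)

section \<open>Identities for a Poisson bracket\<close>

context poisson_algebra
begin

lemmas br_right = derivationsD[OF deriv_right]
lemmas br_left = derivationsD[OF deriv_left]

lemma br_closed [simp, intro]: "\<lbrakk>a \<in> carrier A; b \<in> carrier A\<rbrakk> \<Longrightarrow> br a b \<in> carrier A"
  by (rule br_right)

lemma br_self [simp]: "a \<in> carrier A \<Longrightarrow> br a a = \<zero>\<^bsub>A\<^esub>"
  using lie by (simp add: lie_bracket_def)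

lemma br_jacobi:
  "\<lbrakk>a \<in> carrier A; b \<in> carrier A; c \<in> carrier A\<rbrakk>
    \<Longrightarrow> br a (br b c) \<oplus>\<^bsub>A\<^esub> br b (br c a) \<oplus>\<^bsub>A\<^esub> br c (br a b) = \<zero>\<^bsub>A\<^esub>"
  using lie by (simp add: lie_bracket_def)

lemma br_zero_right [simp]: "a \<in> carrier A \<Longrightarrow> br a \<zero>\<^bsub>A\<^esub> = \<zero>\<^bsub>A\<^esub>"
  using br_right(2)[of a "\<zero>\<^bsub>A\<^esub>" "\<zero>\<^bsub>A\<^esub>"] by (simp add: M.add.l_cancel_one)

lemma br_zero_left [simp]: "a \<in> carrier A \<Longrightarrow> br \<zero>\<^bsub>A\<^esub> a = \<zero>\<^bsub>A\<^esub>"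
  using br_left(2)[of a "\<zero>\<^bsub>A\<^esub>" "\<zero>\<^bsub>A\<^esub>"] by (simp add: M.add.l_cancel_one)

text \<open>Polarisation: the alternating law at \<open>a + b\<close> leaves only the two mixed
  terms.\<close>

lemma br_skew:
  assumes "a \<in> carrier A" "b \<in> carrier A"
  shows "br b a = \<ominus>\<^bsub>A\<^esub> br a b"
proof -
  have "br (a \<oplus>\<^bsub>A\<^esub> b) (a \<oplus>\<^bsub>A\<^esub> b) = br b a \<oplus>\<^bsub>A\<^esub> br a b"
    using assms by (simp add: br_left(2) br_right(2) del: br_self) (simp add: M.a_comm)
  then show ?thesis
    using assms by (simp add: M.minus_equality)
qed

lemma br_minus_right: "\<lbrakk>a \<in> carrier A; b \<in> carrier A\<rbrakk> \<Longrightarrow> br a (\<ominus>\<^bsub>A\<^esub> b) = \<ominus>\<^bsub>A\<^esub> br a b"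
  using br_right(2)[of a "\<ominus>\<^bsub>A\<^esub> b" b] by (simp add: M.l_neg M.minus_equality)

text \<open>The Jacobi identity, with skew symmetry turning its last two terms into the negatives of
  those on the right. It places Hamiltonian maps among the Poisson derivations.\<close>

lemma br_is_poisson_derivation:
  assumes "p \<in> carrier A" "a \<in> carrier A" "b \<in> carrier A"
  shows "br p (br a b) = br (br p a) b \<oplus>\<^bsub>A\<^esub> br a (br p b)"
proof -
  have "br b (br p a) = \<ominus>\<^bsub>A\<^esub> br (br p a) b" "br a (br b p) = \<ominus>\<^bsub>A\<^esub> br a (br p b)"
    using assms by (simp_all add: br_skew[of "br p a" b] br_skew[of p b] br_minus_right)
  then have "br p (br a b) \<oplus>\<^bsub>A\<^esub> \<ominus>\<^bsub>A\<^esub> br a (br p b) \<oplus>\<^bsub>A\<^esub> \<ominus>\<^bsub>A\<^esub> br (br p a) b = \<zero>\<^bsub>A\<^esub>"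
    using br_jacobi[of p a b] assms by simp
  then have "br p (br a b) \<oplus>\<^bsub>A\<^esub> \<ominus>\<^bsub>A\<^esub> (br (br p a) b \<oplus>\<^bsub>A\<^esub> br a (br p b)) = \<zero>\<^bsub>A\<^esub>"
    using assms by (simp add: M.minus_add M.a_ac)
  then show ?thesis
    using assms M.minus_equality[of "br p (br a b)" "\<ominus>\<^bsub>A\<^esub> (br (br p a) b \<oplus>\<^bsub>A\<^esub> br a (br p b))"]
    by (simp del: M.minus_add)
qed

text \<open>\<open>poiss\<close> contains only extensional maps; cutting \<open>X\<close> down to
  the carrier is harmless because sums, products and brackets of its elements stay there.\<close>

lemma poissI:
  assumes "X \<in> derivations R A"
    and "\<And>a b. \<lbrakk>a \<in> carrier A; b \<in> carrier A\<rbrakk> \<Longrightarrow> X (br a b) = br (X a) b \<oplus>\<^bsub>A\<^esub> br a (X b)"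
  shows "restrict X (carrier A) \<in> poiss R A br"
  using derivationsD[OF assms(1)] assms(2)
  by (auto simp: poiss_def intro!: derivationsI)

lemma poissD:
  assumes "X \<in> poiss R A br"
  shows "X \<in> derivations R A" and "X \<in> extensional (carrier A)"
    and "\<lbrakk>a \<in> carrier A; b \<in> carrier A\<rbrakk> \<Longrightarrow> X (br a b) = br (X a) b \<oplus>\<^bsub>A\<^esub> br a (X b)"
  using assms by (auto simp: poiss_def)

section \<open>The module of Poisson derivations and its Hamiltonian submodule\<close>

lemma derivation_add:
  assumes "X \<in> derivations R A" "Y \<in> derivations R A"
  shows "(\<lambda>a. X a \<oplus>\<^bsub>A\<^esub> Y a) \<in> derivations R A"
  using derivationsD[OF assms(1)] derivationsD[OF assms(2)]
  by (intro derivationsI) (auto simp: M.a_ac smult_r_distr r_distr l_distr)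

lemma derivation_smult:
  assumes "r \<in> carrier R" "X \<in> derivations R A"
  shows "(\<lambda>a. r \<odot>\<^bsub>A\<^esub> X a) \<in> derivations R A"
proof (rule derivationsI)
  fix a b assume ab: "a \<in> carrier A" "b \<in> carrier A"
  \<comment> \<open>The algebra law moves a scalar out of the first factor only; commutativity of
    the product handles the second.\<close>
  then have "a \<otimes>\<^bsub>A\<^esub> (r \<odot>\<^bsub>A\<^esub> X b) = r \<odot>\<^bsub>A\<^esub> (a \<otimes>\<^bsub>A\<^esub> X b)"
    using assms derivationsD(1)[OF assms(2)] smult_assoc2[of r "X b" a] by (simp add: m_comm)
  then show "r \<odot>\<^bsub>A\<^esub> X (a \<otimes>\<^bsub>A\<^esub> b) = a \<otimes>\<^bsub>A\<^esub> (r \<odot>\<^bsub>A\<^esub> X b) \<oplus>\<^bsub>A\<^esub> (r \<odot>\<^bsub>A\<^esub> X a) \<otimes>\<^bsub>A\<^esub> b"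
    using assms ab derivationsD[OF assms(2)] by (simp add: smult_r_distr smult_assoc2)
next
  fix s a assume "s \<in> carrier R" "a \<in> carrier A"
  then show "r \<odot>\<^bsub>A\<^esub> X (s \<odot>\<^bsub>A\<^esub> a) = s \<odot>\<^bsub>A\<^esub> (r \<odot>\<^bsub>A\<^esub> X a)"
    using assms(1) derivationsD[OF assms(2)] by (simp add: R.m_comm flip: smult_assoc1)
qed (use assms(1) derivationsD[OF assms(2)] in \<open>auto simp: smult_r_distr\<close>)

text \<open>Both derivation laws are linear in \<open>X\<close>, the one for \<open>br\<close>
  because the bracket is bilinear.\<close>

lemma poiss_module: "module R (fun_module (carrier A) A (poiss R A br))"
proof (rule fun_module_is_module[OF module])
  show "poiss R A br \<subseteq> carrier A \<rightarrow>\<^sub>E carrier A"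
    by (auto simp: poiss_def PiE_def intro: derivationsD(1)[of _ R])
  show "(\<lambda>x\<in>carrier A. \<zero>\<^bsub>A\<^esub>) \<in> poiss R A br"
    by (rule poissI) (auto intro!: derivationsI)
next
  fix X Y assume XY: "X \<in> poiss R A br" "Y \<in> poiss R A br"
  note X = poissD[OF XY(1)] and Y = poissD[OF XY(2)]
  note [simp] = derivationsD(1)[OF X(1)] derivationsD(1)[OF Y(1)]
  show "(\<lambda>x\<in>carrier A. X x \<oplus>\<^bsub>A\<^esub> Y x) \<in> poiss R A br"
    by (rule poissI[OF derivation_add[OF X(1) Y(1)]])
      (simp add: X(3) Y(3) br_left(2) br_right(2) M.a_ac)
next
  fix r X assume r: "r \<in> carrier R" and X': "X \<in> poiss R A br"
  note X = poissD[OF X']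
  note [simp] = derivationsD(1)[OF X(1)]
  show "(\<lambda>x\<in>carrier A. r \<odot>\<^bsub>A\<^esub> X x) \<in> poiss R A br"
    using r by (intro poissI derivation_smult X(1))
      (simp_all add: X(3) br_left(3) br_right(3) smult_r_distr)
qed

text \<open>The assignment of \<open>br p\<close> to \<open>p\<close> is linear, so zero, sums and
  multiples have the explicit Hamiltonians \<open>0\<close>, \<open>p + q\<close> and
  \<open>r p\<close>.\<close>

lemma ham_submodule: "submodule (ham A br) R (fun_module (carrier A) A (poiss R A br))"
proof -
  let ?M = "fun_module (carrier A) A (poiss R A br)"
  interpret P: module R ?M by (rule poiss_module)
  have sub: "ham A br \<subseteq> carrier ?M"
    using deriv_right br_is_poisson_derivation by (auto simp: ham_def intro!: poissI)
  have hamI: "X \<in> ham A br" if "p \<in> carrier A" "X = (\<lambda>a\<in>carrier A. br p a)" for p X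
    using that by (auto simp: ham_def)
  have smult: "r \<odot>\<^bsub>?M\<^esub> X \<in> ham A br" if "r \<in> carrier R" "X \<in> ham A br" for r X
  proof -
    obtain p where p: "p \<in> carrier A" "X = (\<lambda>a\<in>carrier A. br p a)"
      using \<open>X \<in> ham A br\<close> by (auto simp: ham_def)
    then show ?thesis
      using that(1) by (intro hamI[of "r \<odot>\<^bsub>A\<^esub> p"]) (auto simp: br_left(3) fun_eq_iff)
  qed
  show ?thesis
  proof (rule P.submoduleI[OF sub _ _ _ smult])
    show "\<zero>\<^bsub>?M\<^esub> \<in> ham A br"
      by (rule hamI[of "\<zero>\<^bsub>A\<^esub>"]) (auto simp: fun_eq_iff)
    show "\<ominus>\<^bsub>?M\<^esub> X \<in> ham A br" if "X \<in> ham A br" for X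
      using smult[of "\<ominus> \<one>" X] that sub by (simp add: P.smult_l_minus subset_iff del: fun_module_simps)
  next
    fix X Y assume "X \<in> ham A br" "Y \<in> ham A br"
    then obtain p q where "p \<in> carrier A" "q \<in> carrier A"
      "X = (\<lambda>a\<in>carrier A. br p a)" "Y = (\<lambda>a\<in>carrier A. br q a)"
      by (auto simp: ham_def)
    then show "X \<oplus>\<^bsub>?M\<^esub> Y \<in> ham A br"
      by (intro hamI[of "p \<oplus>\<^bsub>A\<^esub> q"]) (auto simp: br_left(2) fun_eq_iff)
  qed
qed

end


section \<open>Admissible Poisson algebras with zero bracket on P1\<close>

lemma semidirect_simps [simp]:
  "carrier (A \<ltimes> M) = carrier A \<times> carrier M"
  "(f, \<eta>) \<otimes>\<^bsub>A \<ltimes> M\<^esub> (g, \<xi>) = (f \<otimes>\<^bsub>A\<^esub> g, f \<odot>\<^bsub>M\<^esub> \<xi> \<oplus>\<^bsub>M\<^esub> g \<odot>\<^bsub>M\<^esub> \<eta>)"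
  "\<zero>\<^bsub>A \<ltimes> M\<^esub> = (\<zero>\<^bsub>A\<^esub>, \<zero>\<^bsub>M\<^esub>)"
  "(f, \<eta>) \<oplus>\<^bsub>A \<ltimes> M\<^esub> (g, \<xi>) = (f \<oplus>\<^bsub>A\<^esub> g, \<eta> \<oplus>\<^bsub>M\<^esub> \<xi>)"
  "r \<odot>\<^bsub>A \<ltimes> M\<^esub> (f, \<eta>) = (r \<odot>\<^bsub>A\<^esub> f, (r \<odot>\<^bsub>A\<^esub> \<one>\<^bsub>A\<^esub>) \<odot>\<^bsub>M\<^esub> \<eta>)"
  by (simp_all add: semidirect_def)

lemma fst_semidirect_add: "fst (p \<oplus>\<^bsub>A \<ltimes> M\<^esub> q) = fst p \<oplus>\<^bsub>A\<^esub> fst q"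
  by (cases p; cases q) simp

lemma fst_semidirect_smult: "fst (r \<odot>\<^bsub>A \<ltimes> M\<^esub> p) = r \<odot>\<^bsub>A\<^esub> fst p"
  by (cases p) simp

text \<open>The support of a symbol lies in \<open>{f}\<close>, hence is finite. For
  \<open>f\<close> outside the carrier the symbol is the zero function, so this holds for every
  \<open>f\<close>.\<close>

lemma kaehler_d_closed:
  fixes A :: "('r, 'a) module"
  assumes "cring A"
  shows "kaehler_d R A f \<in> carrier (kaehler R A)"
proof -
  interpret cring A by fact
  have "finite {h \<in> carrier A. kaehler_symbol A f h \<noteq> \<zero>\<^bsub>A\<^esub>}"
    by (rule finite_subset[of _ "{f}"]) (auto simp: kaehler_symbol_def)
  then have "kaehler_symbol A f \<in> carrier (kaehler_free A)"
    by (auto simp: kaehler_free_def kaehler_symbol_def)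
  then show ?thesis
    by (auto simp: kaehler_def kaehler_d_def A_RCOSETS_def')
qed

section \<open>The bracket expressed through \<open>D\<close> and \<open>K\<close>\<close>

locale admissible_abelian_triple = admissible_poisson_algebra R P0 br0 P1 br
  for R :: "('r, 'x) ring_scheme" and P0 :: "('r, 'a) module" and br0 :: "'a \<Rightarrow> 'a \<Rightarrow> 'a"
    and P1 :: "('a, 'b) module" and br :: "'a \<times> 'b \<Rightarrow> 'a \<times> 'b \<Rightarrow> 'a \<times> 'b" +
  fixes br1 D K
  assumes triple: "corresponding_poisson_triple R P0 br0 P1 br br1 D K"
    and br1_zero: "\<lbrakk>\<eta> \<in> carrier P1; \<xi> \<in> carrier P1\<rbrakk> \<Longrightarrow> br1 \<eta> \<xi> = \<zero>\<^bsub>P1\<^esub>"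
begin

sublocale P1: module P0 P1
  using faithful by (simp add: faithful_module_def)

lemma P1_minus_zero [simp]: "\<ominus>\<^bsub>P1\<^esub> \<zero>\<^bsub>P1\<^esub> = \<zero>\<^bsub>P1\<^esub>"
  by (rule P1.M.minus_equality) simp_all

abbreviation d :: "'a \<Rightarrow> ('a \<Rightarrow> 'a) set" where
  "d \<equiv> kaehler_d R P0"

text \<open>The structure map from \<open>R\<close> to \<open>P0\<close>, through which
  \<open>R\<close> acts on \<open>P1\<close>.\<close>

abbreviation scal :: "'r \<Rightarrow> 'a" where
  "scal r \<equiv> r \<odot>\<^bsub>P0\<^esub> \<one>\<^bsub>P0\<^esub>"

lemma scal_mult:
  "\<lbrakk>r \<in> carrier R; f \<in> carrier P0\<rbrakk> \<Longrightarrow> scal r \<otimes>\<^bsub>P0\<^esub> f = r \<odot>\<^bsub>P0\<^esub> f"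
  by (simp add: P0.smult_assoc2)

lemma scal_smult:
  "\<lbrakk>r \<in> carrier R; f \<in> carrier P0; \<eta> \<in> carrier P1\<rbrakk>
    \<Longrightarrow> (r \<odot>\<^bsub>P0\<^esub> f) \<odot>\<^bsub>P1\<^esub> \<eta> = scal r \<odot>\<^bsub>P1\<^esub> (f \<odot>\<^bsub>P1\<^esub> \<eta>)"
  by (simp add: scal_mult flip: P1.smult_assoc1)

lemma d_closed [simp]: "d f \<in> carrier (kaehler R P0)"
  by (rule kaehler_d_closed[OF P0.M_cring])

lemma D_hom: "D (d f) \<in> mod_hom R (restrict_scalars P0 P1) (restrict_scalars P0 P1)"
proof -
  have "\<forall>\<alpha>\<in>carrier (restrict_scalars P0 (kaehler R P0)).
      D \<alpha> \<in> mod_hom R (restrict_scalars P0 P1) (restrict_scalars P0 P1)"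
    using triple unfolding corresponding_poisson_triple_def contravariant_derivative_def bilinear_maps_def
    by blast
  then show ?thesis
    using d_closed by (simp add: restrict_scalars_def)
qed

lemma D_closed [simp, intro]: "\<eta> \<in> carrier P1 \<Longrightarrow> D (d f) \<eta> \<in> carrier P1"
  using mod_homD(1)[OF D_hom] by (simp add: restrict_scalars_def)

lemma D_zero [simp]: "D (d f) \<zero>\<^bsub>P1\<^esub> = \<zero>\<^bsub>P1\<^esub>"
  using mod_homD(2)[OF D_hom, of "\<zero>\<^bsub>P1\<^esub>" "\<zero>\<^bsub>P1\<^esub>" f]
  by (simp add: restrict_scalars_def P1.M.add.l_cancel_one)

lemma K_closed [simp, intro]: "K (d f) (d g) \<in> carrier P1"
proof -
  have "K (d f) \<in> mod_hom P0 (kaehler R P0) P1"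
    using triple d_closed unfolding corresponding_poisson_triple_def bilinear_maps_def by blast
  then show ?thesis
    by (rule mod_homD) simp
qed

lemma K_skew: "K (d f) (d g) = \<ominus>\<^bsub>P1\<^esub> K (d g) (d f)"
  using triple d_closed unfolding corresponding_poisson_triple_def by blast

text \<open>The vanishing of \<open>br1\<close> is absorbed here, leaving only \<open>D\<close> and
  \<open>K\<close> to compute with.\<close>

lemma br_triple:
  assumes "f \<in> carrier P0" "g \<in> carrier P0" "\<eta> \<in> carrier P1" "\<xi> \<in> carrier P1"
  shows "br (f, \<eta>) (g, \<xi>)
    = (br0 f g, D (d f) \<xi> \<ominus>\<^bsub>P1\<^esub> D (d g) \<eta> \<oplus>\<^bsub>P1\<^esub> K (d f) (d g))"
proof -
  have "br (f, \<eta>) (g, \<xi>)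
      = (br0 f g, D (d f) \<xi> \<ominus>\<^bsub>P1\<^esub> D (d g) \<eta> \<oplus>\<^bsub>P1\<^esub> br1 \<eta> \<xi> \<oplus>\<^bsub>P1\<^esub> K (d f) (d g))"
    using triple assms unfolding corresponding_poisson_triple_def Let_def by blast
  then show ?thesis
    using assms by (simp add: br1_zero)
qed

text \<open>Read off from \<open>br (f, 0) (0, 0) = 0\<close>, where both \<open>D\<close> terms
  vanish, rather than from the relations of the Kaehler module.\<close>

lemma K_zero_right [simp]: "f \<in> carrier P0 \<Longrightarrow> K (d f) (d \<zero>\<^bsub>P0\<^esub>) = \<zero>\<^bsub>P1\<^esub>"
  using P.br_zero_right[of "(f, \<zero>\<^bsub>P1\<^esub>)"] br_triple[of f "\<zero>\<^bsub>P0\<^esub>" "\<zero>\<^bsub>P1\<^esub>" "\<zero>\<^bsub>P1\<^esub>"]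
  by (simp add: a_minus_def)

lemma K_zero_left [simp]: "f \<in> carrier P0 \<Longrightarrow> K (d \<zero>\<^bsub>P0\<^esub>) (d f) = \<zero>\<^bsub>P1\<^esub>"
  by (subst K_skew) simp

text \<open>Now \<open>br (0, 0) (0, \<xi>) = 0\<close> isolates the \<open>D\<close> term, since
  the \<open>K\<close> term is already known to vanish.\<close>

lemma D_d_zero [simp]: "\<xi> \<in> carrier P1 \<Longrightarrow> D (d \<zero>\<^bsub>P0\<^esub>) \<xi> = \<zero>\<^bsub>P1\<^esub>"
  using P.br_zero_left[of "(\<zero>\<^bsub>P0\<^esub>, \<xi>)"] br_triple[of "\<zero>\<^bsub>P0\<^esub>" "\<zero>\<^bsub>P0\<^esub>" "\<zero>\<^bsub>P1\<^esub>" \<xi>]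
  by (simp add: a_minus_def)

text \<open>All terms containing \<open>d 0\<close> vanish; with \<open>br1\<close> zero as well,
  the result does not depend on \<open>\<eta>\<close>.\<close>

lemma br_P1_right:
  assumes "f \<in> carrier P0" "\<eta> \<in> carrier P1" "\<xi> \<in> carrier P1"
  shows "br (f, \<eta>) (\<zero>\<^bsub>P0\<^esub>, \<xi>) = (\<zero>\<^bsub>P0\<^esub>, D (d f) \<xi>)"
  using assms by (simp add: br_triple a_minus_def)

lemma br_P1_left:
  assumes "g \<in> carrier P0" "\<eta> \<in> carrier P1" "\<xi> \<in> carrier P1"
  shows "br (\<zero>\<^bsub>P0\<^esub>, \<eta>) (g, \<xi>) = (\<zero>\<^bsub>P0\<^esub>, \<ominus>\<^bsub>P1\<^esub> D (d g) \<eta>)"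
  using assms by (simp add: br_triple a_minus_def)

text \<open>\<open>D (d f) \<xi>\<close> is the \<open>P1\<close>-component of
  \<open>br (f, 0) (0, \<xi>)\<close>, so its additivity in \<open>f\<close> is that of the bracket.
  Homogeneity follows in the same way below.\<close>

lemma D_d_add:
  assumes "f \<in> carrier P0" "g \<in> carrier P0" "\<xi> \<in> carrier P1"
  shows "D (d (f \<oplus>\<^bsub>P0\<^esub> g)) \<xi> = D (d f) \<xi> \<oplus>\<^bsub>P1\<^esub> D (d g) \<xi>"
  using P.br_left(2)[of "(\<zero>\<^bsub>P0\<^esub>, \<xi>)" "(f, \<zero>\<^bsub>P1\<^esub>)" "(g, \<zero>\<^bsub>P1\<^esub>)"] assms
  by (simp add: br_P1_right)

lemma D_d_smult:
  assumes "r \<in> carrier R" "f \<in> carrier P0" "\<xi> \<in> carrier P1"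
  shows "D (d (r \<odot>\<^bsub>P0\<^esub> f)) \<xi> = scal r \<odot>\<^bsub>P1\<^esub> D (d f) \<xi>"
  using P.br_left(3)[of "(\<zero>\<^bsub>P0\<^esub>, \<xi>)" r "(f, \<zero>\<^bsub>P1\<^esub>)"] assms
  by (simp add: br_P1_right)

section \<open>The module of maps from \<open>P1\<close> to \<open>P0\<close>\<close>

definition E_set :: "('b \<Rightarrow> 'a) set" where
  "E_set = carrier (E_module R P0 br0 P1 D)"

lemma E_setI:
  assumes "\<And>\<eta>. \<eta> \<in> carrier P1 \<Longrightarrow> T \<eta> \<in> carrier P0"
    and "\<And>\<eta> \<xi>. \<lbrakk>\<eta> \<in> carrier P1; \<xi> \<in> carrier P1\<rbrakk> \<Longrightarrow> T (\<eta> \<oplus>\<^bsub>P1\<^esub> \<xi>) = T \<eta> \<oplus>\<^bsub>P0\<^esub> T \<xi>"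
    and "\<And>f \<eta>. \<lbrakk>f \<in> carrier P0; \<eta> \<in> carrier P1\<rbrakk> \<Longrightarrow> T (f \<odot>\<^bsub>P1\<^esub> \<eta>) = f \<otimes>\<^bsub>P0\<^esub> T \<eta>"
    and "\<And>\<eta> \<xi>. \<lbrakk>\<eta> \<in> carrier P1; \<xi> \<in> carrier P1\<rbrakk>
      \<Longrightarrow> T \<xi> \<odot>\<^bsub>P1\<^esub> \<eta> \<oplus>\<^bsub>P1\<^esub> T \<eta> \<odot>\<^bsub>P1\<^esub> \<xi> = \<zero>\<^bsub>P1\<^esub>"
    and "\<And>\<eta> \<xi>. \<lbrakk>\<eta> \<in> carrier P1; \<xi> \<in> carrier P1\<rbrakk> \<Longrightarrow> D (d (T \<eta>)) \<xi> = D (d (T \<xi>)) \<eta>"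
    and "\<And>f \<eta>. \<lbrakk>f \<in> carrier P0; \<eta> \<in> carrier P1\<rbrakk> \<Longrightarrow> T (D (d f) \<eta>) = br0 f (T \<eta>)"
  shows "restrict T (carrier P1) \<in> E_set"
  using assms by (auto simp: E_set_def E_module_def mod_hom_def self_module_def)

lemma E_setD:
  assumes "T \<in> E_set"
  shows "\<eta> \<in> carrier P1 \<Longrightarrow> T \<eta> \<in> carrier P0"
    and "\<lbrakk>\<eta> \<in> carrier P1; \<xi> \<in> carrier P1\<rbrakk> \<Longrightarrow> T (\<eta> \<oplus>\<^bsub>P1\<^esub> \<xi>) = T \<eta> \<oplus>\<^bsub>P0\<^esub> T \<xi>"
    and "\<lbrakk>f \<in> carrier P0; \<eta> \<in> carrier P1\<rbrakk> \<Longrightarrow> T (f \<odot>\<^bsub>P1\<^esub> \<eta>) = f \<otimes>\<^bsub>P0\<^esub> T \<eta>"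
    and "\<lbrakk>\<eta> \<in> carrier P1; \<xi> \<in> carrier P1\<rbrakk>
      \<Longrightarrow> T \<xi> \<odot>\<^bsub>P1\<^esub> \<eta> \<oplus>\<^bsub>P1\<^esub> T \<eta> \<odot>\<^bsub>P1\<^esub> \<xi> = \<zero>\<^bsub>P1\<^esub>"
    and "\<lbrakk>\<eta> \<in> carrier P1; \<xi> \<in> carrier P1\<rbrakk> \<Longrightarrow> D (d (T \<eta>)) \<xi> = D (d (T \<xi>)) \<eta>"
    and "\<lbrakk>f \<in> carrier P0; \<eta> \<in> carrier P1\<rbrakk> \<Longrightarrow> T (D (d f) \<eta>) = br0 f (T \<eta>)"
    and "T \<in> extensional (carrier P1)"
  using assms by (auto simp: E_set_def E_module_def mod_hom_def self_module_def)

lemma E_module_eq: "E_module R P0 br0 P1 D = fun_module (carrier P1) P0 E_set"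
  by (simp add: E_set_def E_module_def)

text \<open>The defining conditions are linear in \<open>T\<close>. The symmetry condition has
  \<open>T\<close> under \<open>d\<close>, which is why \<open>D_d_add\<close> and
  \<open>D_d_smult\<close> are required.\<close>

lemma E_module_is_module: "module R (E_module R P0 br0 P1 D)"
  unfolding E_module_eq
proof (rule fun_module_is_module[OF P0.module])
  show "E_set \<subseteq> carrier P1 \<rightarrow>\<^sub>E carrier P0"
    by (auto simp: PiE_def E_setD(1) E_setD(7))
  show "(\<lambda>\<eta>\<in>carrier P1. \<zero>\<^bsub>P0\<^esub>) \<in> E_set"
    by (rule E_setI) simp_all
next
  fix T S assume TS: "T \<in> E_set" "S \<in> E_set"
  note T = E_setD[OF TS(1)] and S = E_setD[OF TS(2)]
  show "(\<lambda>\<eta>\<in>carrier P1. T \<eta> \<oplus>\<^bsub>P0\<^esub> S \<eta>) \<in> E_set"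
  proof (rule E_setI)
    fix \<eta> \<xi> assume el: "\<eta> \<in> carrier P1" "\<xi> \<in> carrier P1"
    have "(T \<xi> \<oplus>\<^bsub>P0\<^esub> S \<xi>) \<odot>\<^bsub>P1\<^esub> \<eta> \<oplus>\<^bsub>P1\<^esub> (T \<eta> \<oplus>\<^bsub>P0\<^esub> S \<eta>) \<odot>\<^bsub>P1\<^esub> \<xi>
      = (T \<xi> \<odot>\<^bsub>P1\<^esub> \<eta> \<oplus>\<^bsub>P1\<^esub> T \<eta> \<odot>\<^bsub>P1\<^esub> \<xi>) \<oplus>\<^bsub>P1\<^esub> (S \<xi> \<odot>\<^bsub>P1\<^esub> \<eta> \<oplus>\<^bsub>P1\<^esub> S \<eta> \<odot>\<^bsub>P1\<^esub> \<xi>)"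
      using el T(1) S(1) by (simp add: P1.smult_l_distr P1.M.a_ac)
    then show "(T \<xi> \<oplus>\<^bsub>P0\<^esub> S \<xi>) \<odot>\<^bsub>P1\<^esub> \<eta> \<oplus>\<^bsub>P1\<^esub> (T \<eta> \<oplus>\<^bsub>P0\<^esub> S \<eta>) \<odot>\<^bsub>P1\<^esub> \<xi> = \<zero>\<^bsub>P1\<^esub>"
      using el T(4) S(4) by simp
    show "D (d (T \<eta> \<oplus>\<^bsub>P0\<^esub> S \<eta>)) \<xi> = D (d (T \<xi> \<oplus>\<^bsub>P0\<^esub> S \<xi>)) \<eta>"
      using el T(1) S(1) T(5)[OF el] S(5)[OF el] by (simp add: D_d_add)
  qed (use T(1,2,3,6) S(1,2,3,6) in
      \<open>simp_all add: P0.M.a_ac P0.r_distr P0.br_right(2)\<close>)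
next
  fix r T assume r: "r \<in> carrier R" and TE: "T \<in> E_set"
  note T = E_setD[OF TE]
  show "(\<lambda>\<eta>\<in>carrier P1. r \<odot>\<^bsub>P0\<^esub> T \<eta>) \<in> E_set"
  proof (rule E_setI)
    fix \<eta> \<xi> assume el: "\<eta> \<in> carrier P1" "\<xi> \<in> carrier P1"
    \<comment> \<open>The scalar \<open>r\<close> acts through \<open>scal r\<close>, which factors
      out of the sum and leaves the skew relation for \<open>T\<close>.\<close>
    show "(r \<odot>\<^bsub>P0\<^esub> T \<xi>) \<odot>\<^bsub>P1\<^esub> \<eta> \<oplus>\<^bsub>P1\<^esub> (r \<odot>\<^bsub>P0\<^esub> T \<eta>) \<odot>\<^bsub>P1\<^esub> \<xi> = \<zero>\<^bsub>P1\<^esub>"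
      using el r T(1) T(4)[OF el] scal_smult[of r "T \<xi>" \<eta>] scal_smult[of r "T \<eta>" \<xi>]
      by (simp flip: P1.smult_r_distr)
    show "D (d (r \<odot>\<^bsub>P0\<^esub> T \<eta>)) \<xi> = D (d (r \<odot>\<^bsub>P0\<^esub> T \<xi>)) \<eta>"
      using el r T(1) T(5)[OF el] by (simp add: D_d_smult)
  next
    fix f \<eta> assume el: "f \<in> carrier P0" "\<eta> \<in> carrier P1"
    show "r \<odot>\<^bsub>P0\<^esub> T (f \<odot>\<^bsub>P1\<^esub> \<eta>) = f \<otimes>\<^bsub>P0\<^esub> (r \<odot>\<^bsub>P0\<^esub> T \<eta>)"
      using el r T(1)[OF el(2)] P0.smult_assoc2[of r "T \<eta>" f]
      by (simp add: T(3) P0.m_comm)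
  qed (use r T(1,2,6) in \<open>simp_all add: P0.smult_r_distr P0.br_right(3)\<close>)
qed

section \<open>The component of a Poisson derivation from \<open>P1\<close> to
  \<open>P0\<close>\<close>

definition comp01 :: "('a \<times> 'b \<Rightarrow> 'a \<times> 'b) \<Rightarrow> 'b \<Rightarrow> 'a" where
  "comp01 X = (\<lambda>\<eta>\<in>carrier P1. fst (X (\<zero>\<^bsub>P0\<^esub>, \<eta>)))"

lemma comp01_in_E_set:
  assumes "X \<in> poiss R (P0 \<ltimes> P1) br"
  shows "comp01 X \<in> E_set"
  unfolding comp01_def
proof (rule E_setI)
  note X = P.poissD[OF assms] and der = derivationsD[OF P.poissD(1)[OF assms]]
  \<comment> \<open>Homogeneity for the scalar \<open>0\<close> gives the value at zero.\<close>
  have X_zero: "X (\<zero>\<^bsub>P0\<^esub>, \<zero>\<^bsub>P1\<^esub>) = (\<zero>\<^bsub>P0\<^esub>, \<zero>\<^bsub>P1\<^esub>)"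
    using der(3)[of "\<zero>\<^bsub>R\<^esub>" "\<zero>\<^bsub>P0 \<ltimes> P1\<^esub>"] der(1)[of "\<zero>\<^bsub>P0 \<ltimes> P1\<^esub>"]
      P.smult_l_null[of "X (\<zero>\<^bsub>P0\<^esub>, \<zero>\<^bsub>P1\<^esub>)"] P.smult_l_null[of "\<zero>\<^bsub>P0 \<ltimes> P1\<^esub>"]
    by simp
  have X_split: "\<exists>g\<in>carrier P0. \<exists>\<xi>\<in>carrier P1. X (f, \<eta>) = (g, \<xi>)"
    if "f \<in> carrier P0" "\<eta> \<in> carrier P1" for f \<eta>
    using der(1)[of "(f, \<eta>)"] that by (cases "X (f, \<eta>)") auto
  fix \<eta> assume \<eta>: "\<eta> \<in> carrier P1"
  obtain t \<eta>' where \<eta>': "t \<in> carrier P0" "\<eta>' \<in> carrier P1" "X (\<zero>\<^bsub>P0\<^esub>, \<eta>) = (t, \<eta>')"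
    using X_split[of "\<zero>\<^bsub>P0\<^esub>" \<eta>] \<eta> by auto
  show "fst (X (\<zero>\<^bsub>P0\<^esub>, \<eta>)) \<in> carrier P0"
    using \<eta>' by simp
  {
    fix f assume f: "f \<in> carrier P0"
    obtain g \<zeta> where g: "g \<in> carrier P0" "\<zeta> \<in> carrier P1" "X (f, \<zero>\<^bsub>P1\<^esub>) = (g, \<zeta>)"
      using X_split[of f "\<zero>\<^bsub>P1\<^esub>"] f by auto
    \<comment> \<open>In \<open>(f, 0) (t, \<eta>') + (g, \<zeta>) (0, \<eta>)\<close> the second
      summand lies in \<open>P1\<close>, so only \<open>f t\<close> survives in
      \<open>P0\<close>.\<close>
    show "fst (X (\<zero>\<^bsub>P0\<^esub>, f \<odot>\<^bsub>P1\<^esub> \<eta>)) = f \<otimes>\<^bsub>P0\<^esub> fst (X (\<zero>\<^bsub>P0\<^esub>, \<eta>))"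
      using der(4)[of "(f, \<zero>\<^bsub>P1\<^esub>)" "(\<zero>\<^bsub>P0\<^esub>, \<eta>)"] f g \<eta> \<eta>' by simp
    \<comment> \<open>Likewise \<open>br (g, \<zeta>) (0, \<eta>)\<close> lies in \<open>P1\<close>,
      leaving \<open>br0 f t\<close>.\<close>
    show "fst (X (\<zero>\<^bsub>P0\<^esub>, D (d f) \<eta>)) = br0 f (fst (X (\<zero>\<^bsub>P0\<^esub>, \<eta>)))"
      using X(3)[of "(f, \<zero>\<^bsub>P1\<^esub>)" "(\<zero>\<^bsub>P0\<^esub>, \<eta>)"] f g \<eta> \<eta>'
      by (simp add: br_P1_right br_triple a_minus_def)
  }
  fix \<xi> assume \<xi>: "\<xi> \<in> carrier P1"
  obtain s \<xi>' where \<xi>': "s \<in> carrier P0" "\<xi>' \<in> carrier P1" "X (\<zero>\<^bsub>P0\<^esub>, \<xi>) = (s, \<xi>')"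
    using X_split[of "\<zero>\<^bsub>P0\<^esub>" \<xi>] \<xi> by auto
  show "fst (X (\<zero>\<^bsub>P0\<^esub>, \<eta> \<oplus>\<^bsub>P1\<^esub> \<xi>)) = fst (X (\<zero>\<^bsub>P0\<^esub>, \<eta>)) \<oplus>\<^bsub>P0\<^esub> fst (X (\<zero>\<^bsub>P0\<^esub>, \<xi>))"
    using der(2)[of "(\<zero>\<^bsub>P0\<^esub>, \<eta>)" "(\<zero>\<^bsub>P0\<^esub>, \<xi>)"] \<eta> \<eta>' \<xi> \<xi>' by simp
  \<comment> \<open>Elements of \<open>P1\<close> multiply to zero, so the
    \<open>P1\<close>-component of the Leibniz rule, \<open>s \<eta> + t \<xi>\<close>, is
    zero.\<close>
  show "fst (X (\<zero>\<^bsub>P0\<^esub>, \<xi>)) \<odot>\<^bsub>P1\<^esub> \<eta> \<oplus>\<^bsub>P1\<^esub> fst (X (\<zero>\<^bsub>P0\<^esub>, \<eta>)) \<odot>\<^bsub>P1\<^esub> \<xi> = \<zero>\<^bsub>P1\<^esub>"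
    using der(4)[of "(\<zero>\<^bsub>P0\<^esub>, \<eta>)" "(\<zero>\<^bsub>P0\<^esub>, \<xi>)"] \<eta> \<eta>' \<xi> \<xi>' by (simp add: X_zero)
  \<comment> \<open>Elements of \<open>P1\<close> also have zero bracket, and by
    \<open>br_P1_right\<close> and \<open>br_P1_left\<close> the components \<open>\<eta>'\<close>
    and \<open>\<xi>'\<close> drop out of the two remaining brackets.\<close>
  have "D (d t) \<xi> \<oplus>\<^bsub>P1\<^esub> \<ominus>\<^bsub>P1\<^esub> D (d s) \<eta> = \<zero>\<^bsub>P1\<^esub>"
    using X(3)[of "(\<zero>\<^bsub>P0\<^esub>, \<eta>)" "(\<zero>\<^bsub>P0\<^esub>, \<xi>)"] \<eta> \<eta>' \<xi> \<xi>'
    by (simp add: X_zero br_P1_right br_P1_left)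
  then show "D (d (fst (X (\<zero>\<^bsub>P0\<^esub>, \<eta>)))) \<xi> = D (d (fst (X (\<zero>\<^bsub>P0\<^esub>, \<xi>)))) \<eta>"
    using \<eta> \<eta>' \<xi> \<xi>' P1.M.minus_equality[of "D (d t) \<xi>" "\<ominus>\<^bsub>P1\<^esub> D (d s) \<eta>"] by simp
qed

section \<open>The exact sequence for Poisson cohomology\<close>

abbreviation poiss_mod :: "('r, 'a \<times> 'b \<Rightarrow> 'a \<times> 'b) module" where
  "poiss_mod \<equiv> fun_module (carrier (P0 \<ltimes> P1)) (P0 \<ltimes> P1) (poiss R (P0 \<ltimes> P1) br)"

lemma comp01_hom: "comp01 \<in> mod_hom R poiss_mod (E_module R P0 br0 P1 D)"
  using comp01_in_E_set
  by (auto simp: mod_hom_def E_module_eq comp01_def fst_semidirect_add fst_semidirect_smult fun_eq_iff)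

lemma kernel_comp01:
  "a_kernel poiss_mod (E_module R P0 br0 P1 D) comp01 = poiss1 R P0 P1 br"
  by (auto simp: a_kernel_def' E_module_eq comp01_def poiss1_def fun_eq_iff)

text \<open>Every bracket with an element of \<open>P1\<close> has zero \<open>P0\<close>-component,
  by \<open>br_P1_right\<close>. This is what lets \<open>comp01\<close> descend to the
  quotient.\<close>

lemma ham_subset_poiss1: "ham (P0 \<ltimes> P1) br \<subseteq> poiss1 R P0 P1 br"
  using P.poiss_module[THEN module.submoduleE(1), OF P.ham_submodule]
  by (auto simp: poiss1_def ham_def br_P1_right)

text \<open>
  Cosets do not depend on the ambient carrier, so the class of \<open>X\<close> is literally the same set in both
  quotients and the inclusion is the identity.
\<close>

lemma left_exact:
  "left_exact_seq R (poisson_H1_rest R P0 P1 br) (poisson_H1 R (P0 \<ltimes> P1) br)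
     (E_module R P0 br0 P1 D) (\<lambda>C. C) (coset_map comp01)"
proof -
  \<comment> \<open>Identifies the kernel, taken with the operations of \<open>poiss_mod\<close>,
    with the module whose quotient is \<open>poisson_H1_rest\<close>.\<close>
  have "poiss_mod\<lparr>carrier := poiss1 R P0 P1 br\<rparr>
      = fun_module (carrier (P0 \<ltimes> P1)) (P0 \<ltimes> P1) (poiss1 R P0 P1 br)"
    by (simp add: fun_module_def)
  then show ?thesis
    using quot_left_exact[OF P.poiss_module P.ham_submodule E_module_is_module comp01_hom]
      ham_subset_poiss1
    unfolding kernel_comp01 poisson_H1_rest_def poisson_H1_def by simp
qed

end

theorem theorem8p15:
  fixes R :: "('r, 'x) ring_scheme"
    and P0 :: "('r, 'a) module" and br0 :: "'a \<Rightarrow> 'a \<Rightarrow> 'a"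
    and P1 :: "('a, 'b) module" and br :: "'a \<times> 'b \<Rightarrow> 'a \<times> 'b \<Rightarrow> 'a \<times> 'b"
    and br1 :: "'b \<Rightarrow> 'b \<Rightarrow> 'b"
    and D :: "('a \<Rightarrow> 'a) set \<Rightarrow> 'b \<Rightarrow> 'b"
    and K :: "('a \<Rightarrow> 'a) set \<Rightarrow> ('a \<Rightarrow> 'a) set \<Rightarrow> 'b"
  assumes "admissible_poisson_algebra R P0 br0 P1 br"
    and "corresponding_poisson_triple R P0 br0 P1 br br1 D K"
    and "\<forall>\<eta>\<in>carrier P1. \<forall>\<xi>\<in>carrier P1. br1 \<eta> \<xi> = \<zero>\<^bsub>P1\<^esub>"
  shows "\<exists>\<iota> \<phi>. left_exact_seq R (poisson_H1_rest R P0 P1 br) (poisson_H1 R (P0 \<ltimes> P1) br)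
           (E_module R P0 br0 P1 D) \<iota> \<phi>"
proof -
  interpret admissible_abelian_triple R P0 br0 P1 br br1 D K
    using assms by (simp add: admissible_abelian_triple_def admissible_abelian_triple_axioms_def)
  show ?thesis
    using left_exact by blast
qed

end
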